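(* $\mathsf{tJ}(\mathrm{id})\equiv_{\mathrm W}\mathsf{X}_{\Pi}$, where $\mathrm{id}$ is the identity on $\mathbb{N}^{\mathbb{N}}$ and $\mathsf{X}_{\Pi}:\mathbb{N}^{\mathbb{N}}\rightrightarrows\mathbb{N}^{\mathbb{N}}$ is the total problem $$\mathsf{X}_{\Pi}(p)=\{q\in\mathbb{N}^{\mathbb{N}} : (\exists^\infty n)(p(n)=0)\iff(\forall n)(q(n)=0)\}.$$
   Context: A problem is a partial multi-valued function $f:\subseteq\mathbb{N}^{\mathbb{N}}\rightrightarrows\mathbb{N}^{\mathbb{N}}$, with $\mathrm{dom}(f)=\{p: f(p)\ne\emptyset\}$. $f\le_{\mathrm W} g$ means there are partial computable functionals $\Phi:\subseteq\mathbb{N}^{\mathbb{N}}\to\mathbb{N}^{\mathbb{N}}$ and $\Psi:\subseteq\mathbb{N}^{\mathbb{N}}\times\mathbb{N}^{\mathbb{N}}\to\mathbb{N}^{\mathbb{N}}$ such that for every $p\in\mathrm{dom}(f)$: $\Phi(p)\in\mathrm{dom}(g)$ and $\Psi(p,q)\in f(p)$ for every $q\in g(\Phi(p))$. $f\equiv_{\mathrm W} g$ means $f\le_{\mathrm W} g$ and $g\le_{\mathrm W} f$. Finite products of copies of $\mathbb{N}$ and $\mathbb{N}^{\mathbb{N}}$ are identified with $\mathbb{N}^{\mathbb{N}}$ via standard computable codings. $(\Phi_e)_{e\in\mathbb{N}}$ is a fixed standard computable enumeration of the partial computable functionals on $\mathbb{N}^{\mathbb{N}}$; $\Phi_i(p,q)$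 means $\Phi_i$ applied to the pair $(p,q)$; $\downarrow$ means defined. Tot-jump: for $e,i\in\mathbb{N}$, $p\in\mathbb{N}^{\mathbb{N}}$, $\mathsf{tJ}(f)(e,i,p)=\{\Phi_i(p,q): q\in f(\Phi_e(p))\}$ if $\Phi_e(p)\in\mathrm{dom}(f)$ and $\Phi_i(p,q)\downarrow$ for all $q\in f(\Phi_e(p))$; otherwise $\mathsf{tJ}(f)(e,i,p)=\mathbb{N}^{\mathbb{N}}$. The quantifier $\exists^\infty n$ means "there are infinitely many $n$". *)

theory Defs
  imports Main "HOL-Library.Nat_Bijection"
begin

type_synonym baire = "nat \<Rightarrow> nat"

section \<open>Partial computable functionals on Baire space\<close>

text \<open>
  Partial recursive functions relative to an oracle: programs denote unary partial functions
  on the naturals; several arguments are passed through the Cantor pairing function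
  \<^const>\<open>prod_encode\<close>.
\<close>

datatype prog =
    PZero
  | PSucc
  | PFst
  | PSnd
  | POracle
  | PPair prog prog
  | PComp prog prog
  | PRec prog prog
  | PMu prog

primrec eval :: "baire \<Rightarrow> prog \<Rightarrow> nat \<Rightarrow> nat option" where
  "eval p PZero = (\<lambda>x. Some 0)"
| "eval p PSucc = (\<lambda>x. Some (Suc x))"
| "eval p PFst = (\<lambda>x. Some (fst (prod_decode x)))"
| "eval p PSnd = (\<lambda>x. Some (snd (prod_decode x)))"
| "eval p POracle = (\<lambda>x. Some (p x))"
| "eval p (PPair f g) =
     (\<lambda>x. Option.bind (eval p f x) (\<lambda>a. Option.bind (eval p g x) (\<lambda>b. Some (prod_encode (a, b)))))"
| "eval p (PComp f g) = (\<lambda>x. Option.bind (eval p g x) (eval p f))"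
| "eval p (PRec f g) =
     (\<lambda>x. rec_nat (eval p f (fst (prod_decode x)))
       (\<lambda>m r. Option.bind r
         (\<lambda>y. eval p g (prod_encode (fst (prod_decode x), prod_encode (m, y)))))
       (snd (prod_decode x)))"
| "eval p (PMu f) =
     (\<lambda>x. if \<exists>n. eval p f (prod_encode (x, n)) = Some 0 \<and>
                (\<forall>m<n. eval p f (prod_encode (x, m)) \<noteq> None)
          then Some (LEAST n. eval p f (prod_encode (x, n)) = Some 0)
          else None)"

text \<open>A functional is defined at an oracle only if the program halts on every input.\<close>

definition functional :: "prog \<Rightarrow> baire \<Rightarrow> baire option" where
  "functional c p =
     (if \<forall>n. eval p c n \<noteq> None then Some (\<lambda>n. the (eval p c n)) else None)"

definition computable_functional :: "(baire \<Rightarrow> baire option) \<Rightarrow> bool" where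
  "computable_functional F \<longleftrightarrow> (\<exists>c. F = functional c)"

primrec encode :: "prog \<Rightarrow> nat" where
  "encode PZero = prod_encode (0, 0)"
| "encode PSucc = prod_encode (1, 0)"
| "encode PFst = prod_encode (2, 0)"
| "encode PSnd = prod_encode (3, 0)"
| "encode POracle = prod_encode (4, 0)"
| "encode (PPair f g) = prod_encode (5, prod_encode (encode f, encode g))"
| "encode (PComp f g) = prod_encode (6, prod_encode (encode f, encode g))"
| "encode (PRec f g) = prod_encode (7, prod_encode (encode f, encode g))"
| "encode (PMu f) = prod_encode (8, encode f)"

lemma encode_inject: "encode c = encode d \<longleftrightarrow> c = d"
proof (induction c arbitrary: d)
  case PZero then show ?case by (cases d) auto
next
  case PSucc then show ?case by (cases d) auto
next
  case PFst then show ?case by (cases d) auto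
next
  case PSnd then show ?case by (cases d) auto
next
  case POracle then show ?case by (cases d) auto
next
  case (PPair f g) then show ?case by (cases d) auto
next
  case (PComp f g) then show ?case by (cases d) auto
next
  case (PRec f g) then show ?case by (cases d) auto
next
  case (PMu f) then show ?case by (cases d) auto
qed

text \<open>Numbers that encode no program are indices of the nowhere defined functional.\<close>

definition Phi :: "nat \<Rightarrow> baire \<Rightarrow> baire option" where
  "Phi e = (if \<exists>c. encode c = e then functional (THE c. encode c = e) else (\<lambda>p. None))"

lemma Phi_encode [simp]: "Phi (encode c) = functional c"
  by (auto simp: Phi_def encode_inject)

lemma computable_functional_iff_Phi: "computable_functional F \<longleftrightarrow> (\<exists>e. F = Phi e)"
proof
  assume "computable_functional F"
  then obtain c where "F = functional c" by (auto simp: computable_functional_def)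
  then have "F = Phi (encode c)" by simp
  then show "\<exists>e. F = Phi e" ..
next
  assume "\<exists>e. F = Phi e"
  then obtain e where e: "F = Phi e" ..
  have empty: "functional (PMu PSucc) = (\<lambda>p. None)"
    by (auto simp: functional_def fun_eq_iff)
  show "computable_functional F"
  proof (cases "\<exists>c. encode c = e")
    case True
    then show ?thesis using e by (auto simp: computable_functional_def)
  next
    case False
    then have "F = functional (PMu PSucc)" using e empty by (simp add: Phi_def)
    then show ?thesis by (auto simp: computable_functional_def)
  qed
qed

section \<open>Codings of products\<close>

text \<open>
  The identifications of \<open>\<nat> \<times> \<nat>\<^sup>\<nat>\<close> and of \<open>\<nat>\<^sup>\<nat> \<times> \<nat>\<^sup>\<nat>\<close> with \<open>\<nat>\<^sup>\<nat>\<close>: prepending a number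
  and interleaving two sequences. Both are bijections.
\<close>

definition cons_seq :: "nat \<Rightarrow> baire \<Rightarrow> baire" where
  "cons_seq n p = case_nat n p"

definition pair_seq :: "baire \<Rightarrow> baire \<Rightarrow> baire" where
  "pair_seq p q = (\<lambda>n. if even n then p (n div 2) else q (n div 2))"

lemma bij_cons_seq: "bij (\<lambda>(n, p). cons_seq n p)"
proof (rule bij_betw_byWitness[where f' = "\<lambda>r. (r 0, \<lambda>n. r (Suc n))"])
qed (auto simp: cons_seq_def fun_eq_iff split: nat.split)

lemma bij_pair_seq: "bij (\<lambda>(p, q). pair_seq p q)"
proof (rule bij_betw_byWitness[where f' = "\<lambda>r. (\<lambda>n. r (2 * n), \<lambda>n. r (2 * n + 1))"])
qed (auto simp: pair_seq_def fun_eq_iff)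

section \<open>Problems and Weihrauch reducibility\<close>

text \<open>A partial multi-valued function is undefined where its value is the empty set.\<close>

type_synonym problem = "baire \<Rightarrow> baire set"

definition pdom :: "problem \<Rightarrow> baire set" where
  "pdom f = {p. f p \<noteq> {}}"

definition W_le :: "problem \<Rightarrow> problem \<Rightarrow> bool"  (infix \<open>\<le>W\<close> 50) where
  "f \<le>W g \<longleftrightarrow>
     (\<exists>F G. computable_functional F \<and> computable_functional G \<and>
        (\<forall>p\<in>pdom f. \<exists>r. F p = Some r \<and> r \<in> pdom g \<and>
           (\<forall>q\<in>g r. \<exists>s. G (pair_seq p q) = Some s \<and> s \<in> f p)))"

definition W_equiv :: "problem \<Rightarrow> problem \<Rightarrow> bool"  (infix \<open>\<equiv>W\<close> 50) where
  "f \<equiv>W g \<longleftrightarrow> f \<le>W g \<and> g \<le>W f"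

definition id_problem :: problem where
  "id_problem p = {p}"

definition tot_jump :: "problem \<Rightarrow> nat \<Rightarrow> nat \<Rightarrow> baire \<Rightarrow> baire set" where
  "tot_jump f e i p =
     (if \<exists>r. Phi e p = Some r \<and> r \<in> pdom f \<and> (\<forall>q\<in>f r. Phi i (pair_seq p q) \<noteq> None)
      then {the (Phi i (pair_seq p q)) | q. q \<in> f (the (Phi e p))}
      else UNIV)"

definition tJ :: "problem \<Rightarrow> problem" where
  "tJ f s = tot_jump f (s 0) (s 1) (\<lambda>n. s (n + 2))"

lemma tJ_cons_seq: "tJ f (cons_seq e (cons_seq i p)) = tot_jump f e i p"
  by (simp add: tJ_def cons_seq_def)

definition X_Pi :: problem where
  "X_Pi p = {q. infinite {n. p n = 0} \<longleftrightarrow> (\<forall>n. q n = 0)}"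

end

theory Submission imports Defs "HOL-Library.Infinite_Set" begin

text \<open>
  That a computation halts on every input, and that an event occurs infinitely often, can be
  translated into each other; each reduction is one of the translations.

  \<^emph>\<open>Reducing \<open>X_Pi\<close> to the jump.\<close> Given \<open>p\<close>, ask the jump for the function
  \<open>n \<mapsto> LEAST m. p (n + m) = 0\<close>, which is computable from \<open>p\<close> and total exactly if \<open>p\<close> has infinitely
  many zeros. From the answer \<open>q\<close> return \<open>n \<mapsto> p (n + q n)\<close>, that is, check whether \<open>q n\<close> really leads to
  a zero. If \<open>p\<close> has infinitely many zeros then \<open>q\<close> is the requested function and the check yields
  zero everywhere; if not, then whatever \<open>q\<close> is, the check fails at every large \<open>n\<close>.

  \<^emph>\<open>Reducing the jump to \<open>X_Pi\<close>.\<close> An instance \<open>s\<close> consists of two indices \<open>e\<close>, \<open>i\<close> and an oracle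
  \<open>p\<close>, and asks for \<open>\<Phi>\<^sub>i (p, \<Phi>\<^sub>e p)\<close> if this is defined. A universal machine computes this function
  at 0, then at 1, and so on; let \<open>flag s\<close> be zero at the stages where the machine has just
  finished an input. It has infinitely many zeros if the function is total. Given \<open>q\<close> in
  \<open>X_Pi (flag s)\<close>, the value to return at \<open>n\<close> is found by waiting until either the machine
  finishes input \<open>n\<close>, or a number \<open>t\<close> with \<open>q t \<noteq> 0\<close> turns up. One of the two happens: if \<open>q\<close> is
  zero everywhere, the flag has infinitely many zeros and so the machine finishes every input.
  If the function is total, \<open>q\<close> is zero everywhere and the values are the right ones; if it is not
  total, every sequence is a solution.

  The universal machine is a stack machine (\<open>step\<close>), so that one step is a mere case distinction
  and no recursion over programs has to be computed. The proof rests on one half of its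
  correctness (\<open>machine_simulates_eval\<close>): if a program has a value, the machine finds it.
  Where the programs have no value, every behaviour of the machine is harmless, because then
  every sequence is a solution.
\<close>

section \<open>Total computable functions relative to an oracle\<close>

abbreviation npair :: "nat \<Rightarrow> nat \<Rightarrow> nat" where
  "npair a b \<equiv> prod_encode (a, b)"

abbreviation nfst :: "nat \<Rightarrow> nat" where
  "nfst z \<equiv> fst (prod_decode z)"

abbreviation nsnd :: "nat \<Rightarrow> nat" where
  "nsnd z \<equiv> snd (prod_decode z)"

text \<open>
  It suffices to know that programs exist, so computability is treated as a closure property of
  functions; composite functions are then handled by applying introduction rules to their
  defining terms.
\<close>

definition total_computable :: "(baire \<Rightarrow> nat \<Rightarrow> nat) \<Rightarrow> bool" where
  "total_computable f \<longleftrightarrow> (\<exists>c. \<forall>p x. eval p c x = Some (f p x))"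

named_theorems computable_intros

lemma total_computable_const [computable_intros]: "total_computable (\<lambda>p x. k)"
proof (induction k)
  case 0
  have "\<forall>p x. eval p PZero x = Some 0" by simp
  then show ?case unfolding total_computable_def by blast
next
  case (Suc k)
  then obtain c where "\<forall>p x. eval p c x = Some k" unfolding total_computable_def by blast
  then have "\<forall>p x. eval p (PComp PSucc c) x = Some (Suc k)" by simp
  then show ?case unfolding total_computable_def by blast
qed

lemma total_computable_id [computable_intros]: "total_computable (\<lambda>p x. x)"
proof -
  have "\<forall>p x. eval p (PPair PFst PSnd) x = Some x" by simp
  then show ?thesis unfolding total_computable_def by blast
qed

lemma total_computable_compose:
  assumes "total_computable f" "total_computable g"
  shows "total_computable (\<lambda>p x. f p (g p x))"
proof -
  obtain c d where "\<forall>p x. eval p c x = Some (f p x)" "\<forall>p x. eval p d x = Some (g p x)"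
    using assms unfolding total_computable_def by blast
  then have "\<forall>p x. eval p (PComp c d) x = Some (f p (g p x))" by simp
  then show ?thesis unfolding total_computable_def by blast
qed

lemma total_computable_Suc [computable_intros]:
  assumes "total_computable f"
  shows "total_computable (\<lambda>p x. Suc (f p x))"
proof -
  have "\<forall>p x. eval p PSucc x = Some (Suc x)" by simp
  then have "total_computable (\<lambda>p. Suc)" unfolding total_computable_def by blast
  from total_computable_compose[OF this assms] show ?thesis .
qed

lemma total_computable_nfst [computable_intros]:
  assumes "total_computable f"
  shows "total_computable (\<lambda>p x. nfst (f p x))"
proof -
  have "\<forall>p x. eval p PFst x = Some (nfst x)" by simp
  then have "total_computable (\<lambda>p x. nfst x)" unfolding total_computable_def by blast
  from total_computable_compose[OF this assms] show ?thesis .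
qed

lemma total_computable_nsnd [computable_intros]:
  assumes "total_computable f"
  shows "total_computable (\<lambda>p x. nsnd (f p x))"
proof -
  have "\<forall>p x. eval p PSnd x = Some (nsnd x)" by simp
  then have "total_computable (\<lambda>p x. nsnd x)" unfolding total_computable_def by blast
  from total_computable_compose[OF this assms] show ?thesis .
qed

lemma total_computable_oracle [computable_intros]:
  assumes "total_computable f"
  shows "total_computable (\<lambda>p x. p (f p x))"
proof -
  have "\<forall>p x. eval p POracle x = Some (p x)" by simp
  then have "total_computable (\<lambda>p. p)" unfolding total_computable_def by blast
  from total_computable_compose[OF this assms] show ?thesis .
qed

lemma total_computable_npair [computable_intros]:
  assumes "total_computable f" "total_computable g"
  shows "total_computable (\<lambda>p x. npair (f p x) (g p x))"
proof -
  obtain c d where "\<forall>p x. eval p c x = Some (f p x)" "\<forall>p x. eval p d x = Some (g p x)"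
    using assms unfolding total_computable_def by blast
  then have "\<forall>p x. eval p (PPair c d) x = Some (npair (f p x) (g p x))" by simp
  then show ?thesis unfolding total_computable_def by blast
qed

lemma total_computable_rec:
  assumes "total_computable f" "total_computable g" "total_computable k"
  shows "total_computable
    (\<lambda>p x. rec_nat (f p x) (\<lambda>m r. g p (npair x (npair m r))) (k p x))"
proof -
  obtain c d where c: "\<And>p x. eval p c x = Some (f p x)" and d: "\<And>p x. eval p d x = Some (g p x)"
    using assms(1,2) unfolding total_computable_def by blast
  have rec: "rec_nat (Some a) (\<lambda>m r. Option.bind r (\<lambda>y. Some (h m y))) n = Some (rec_nat a h n)"
    for a :: nat and h n
    by (induction n) auto
  have "\<forall>p x. eval p (PRec c d) x =
      Some (rec_nat (f p (nfst x)) (\<lambda>m r. g p (npair (nfst x) (npair m r))) (nsnd x))"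
    by (simp add: c d rec)
  then have "total_computable
      (\<lambda>p x. rec_nat (f p (nfst x)) (\<lambda>m r. g p (npair (nfst x) (npair m r))) (nsnd x))"
    unfolding total_computable_def by blast
  from total_computable_compose[OF this total_computable_npair[OF total_computable_id assms(3)]]
  show ?thesis by simp
qed

lemma total_computable_funpow [computable_intros]:
  assumes "total_computable h" "total_computable k" "total_computable a"
  shows "total_computable (\<lambda>p x. (h p ^^ k p x) (a p x))"
proof -
  have "total_computable (\<lambda>p z. h p (nsnd (nsnd z)))"
    by (intro total_computable_compose[OF assms(1)] computable_intros)
  from total_computable_rec[OF assms(3) this assms(2)]
  have "total_computable (\<lambda>p x. rec_nat (a p x) (\<lambda>m r. h p r) (k p x))" by simp
  moreover have "rec_nat b (\<lambda>m r. g r) n = (g ^^ n) b" for b :: nat and g n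
    by (induction n) auto
  ultimately show ?thesis by simp
qed

lemma total_computable_add [computable_intros]:
  assumes "total_computable f" "total_computable g"
  shows "total_computable (\<lambda>p x. f p x + g p x)"
proof -
  have "total_computable (\<lambda>p. Suc)" by (intro computable_intros)
  from total_computable_funpow[OF this assms] show ?thesis by simp
qed

lemma total_computable_pred:
  assumes "total_computable f"
  shows "total_computable (\<lambda>p x. f p x - 1)"
proof -
  have "total_computable (\<lambda>p x. rec_nat 0 (\<lambda>m r. nfst (nsnd (npair x (npair m r)))) x)"
    by (rule total_computable_rec) (intro computable_intros)+
  moreover have "rec_nat 0 (\<lambda>m r. m) n = n - 1" for n :: nat by (cases n) auto
  ultimately have "total_computable (\<lambda>p x. x - 1)" by simp
  from total_computable_compose[OF this assms] show ?thesis .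
qed

lemma total_computable_diff [computable_intros]:
  assumes "total_computable f" "total_computable g"
  shows "total_computable (\<lambda>p x. f p x - g p x)"
proof -
  have "total_computable (\<lambda>p x. x - 1)" by (intro total_computable_pred computable_intros)
  from total_computable_funpow[OF this assms(2,1)]
  have "total_computable (\<lambda>p x. ((\<lambda>x. x - 1) ^^ g p x) (f p x))" .
  moreover have "((\<lambda>x. x - 1) ^^ n) b = b - n" for b n :: nat
    by (induction n) auto
  ultimately show ?thesis by simp
qed

text \<open>
  Equality is tested by the sum of the two truncated differences, which vanishes exactly if the
  numbers agree; a recursion on that sum then forgets its recursive value.
\<close>

lemma total_computable_if [computable_intros]:
  assumes "total_computable f" "total_computable g" "total_computable a" "total_computable b"
  shows "total_computable (\<lambda>p x. if f p x = g p x then a p x else b p x)"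
proof -
  have "total_computable (\<lambda>p z. b p (nfst z))"
    by (intro total_computable_compose[OF assms(4)] computable_intros)
  moreover have "total_computable (\<lambda>p x. (f p x - g p x) + (g p x - f p x))"
    by (intro computable_intros assms)
  ultimately have "total_computable (\<lambda>p x. rec_nat (a p x)
      (\<lambda>m r. b p (nfst (npair x (npair m r)))) ((f p x - g p x) + (g p x - f p x)))"
    by (rule total_computable_rec[OF assms(3)])
  moreover have "rec_nat u (\<lambda>m r. v) ((i - j) + (j - i)) = (if i = j then u else v)"
    for u v i j :: nat
    by (cases "(i - j) + (j - i)") auto
  ultimately show ?thesis by simp
qed

text \<open>Counting upwards in the form (quotient, remainder) gives both functions at once.\<close>

lemma total_computable_div2_mod2:
  assumes "total_computable f"
  shows "total_computable (\<lambda>p x. f p x div 2)" "total_computable (\<lambda>p x. f p x mod 2)"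
proof -
  let ?h = "\<lambda>z. if nsnd z = 0 then npair (nfst z) 1 else npair (Suc (nfst z)) 0"
  have "(?h ^^ n) (npair 0 0) = npair (n div 2) (n mod 2)" for n
    by (induction n) (auto simp: div_Suc mod_Suc)
  moreover have "total_computable (\<lambda>p x. (?h ^^ f p x) (npair 0 0))"
    by (intro computable_intros assms)
  ultimately have "total_computable (\<lambda>p x. npair (f p x div 2) (f p x mod 2))" by simp
  from total_computable_nfst[OF this] total_computable_nsnd[OF this]
  show "total_computable (\<lambda>p x. f p x div 2)" "total_computable (\<lambda>p x. f p x mod 2)"
    by simp_all
qed

lemmas [computable_intros] = total_computable_div2_mod2

text \<open>Replaces every oracle call by a program, which computes the new oracle from the old one.\<close>

primrec plug_oracle :: "prog \<Rightarrow> prog \<Rightarrow> prog" where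
  "plug_oracle d PZero = PZero"
| "plug_oracle d PSucc = PSucc"
| "plug_oracle d PFst = PFst"
| "plug_oracle d PSnd = PSnd"
| "plug_oracle d POracle = d"
| "plug_oracle d (PPair f g) = PPair (plug_oracle d f) (plug_oracle d g)"
| "plug_oracle d (PComp f g) = PComp (plug_oracle d f) (plug_oracle d g)"
| "plug_oracle d (PRec f g) = PRec (plug_oracle d f) (plug_oracle d g)"
| "plug_oracle d (PMu f) = PMu (plug_oracle d f)"

lemma eval_plug_oracle:
  assumes "\<And>x. eval p d x = Some (r x)"
  shows "eval p (plug_oracle d c) = eval r c"
proof (induction c)
  case (PComp f g)
  then show ?case by (simp only: plug_oracle.simps eval.simps)
next
  case (PMu f)
  then show ?case by (simp only: plug_oracle.simps eval.simps)
qed (simp_all add: assms)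

lemma total_computable_change_oracle:
  assumes "total_computable f" "total_computable h"
  shows "total_computable (\<lambda>p x. f (h p) x)"
proof -
  obtain c d where c: "\<And>p x. eval p c x = Some (f p x)" and d: "\<And>p x. eval p d x = Some (h p x)"
    using assms unfolding total_computable_def by blast
  have "\<forall>p x. eval p (plug_oracle d c) x = Some (f (h p) x)"
    by (simp add: eval_plug_oracle[OF d] c)
  then show ?thesis unfolding total_computable_def by blast
qed

lemma total_functional:
  assumes "total_computable f"
  shows "\<exists>c. \<forall>p. functional c p = Some (f p)"
proof -
  obtain c where "\<And>p x. eval p c x = Some (f p x)"
    using assms unfolding total_computable_def by blast
  then have "\<forall>p. functional c p = Some (f p)" by (simp add: functional_def)
  then show ?thesis ..
qed

text \<open>
  Unbounded search is the only source of partiality in the reductions; it is used at oracles for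
  which every search succeeds.
\<close>

lemma search_functional:
  assumes "total_computable test" "total_computable v"
  shows "\<exists>c. \<forall>p. (\<forall>n. \<exists>t. test p (npair n t) = 0) \<longrightarrow>
    functional c p = Some (\<lambda>n. v p (npair n (LEAST t. test p (npair n t) = 0)))"
proof -
  obtain a b where a: "\<And>p x. eval p a x = Some (test p x)" and b: "\<And>p x. eval p b x = Some (v p x)"
    using assms unfolding total_computable_def by blast
  show ?thesis
    by (rule exI[of _ "PComp b (PPair (PPair PFst PSnd) (PMu a))"]) (simp add: functional_def a b)
qed

section \<open>A stack machine for programs given by their codes\<close>

text \<open>
  A configuration either evaluates a program code at an argument, or returns a value, in
  both cases to a stack of frames. A frame holds a mode, a code and an argument: what remains to
  be done once the value arrives, with 0 in the fields that its tag has no use for. Modes tell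
  the two oracles apart: in mode 0 programs run relative to \<open>p\<close>, in mode 1 relative to the pair
  of \<open>p\<close> and \<open>\<Phi>\<^sub>e p\<close>. An evaluating configuration is coded like a frame with tag 0; the frames on
  the stack have tags 1 to 5.
\<close>

abbreviation frame :: "nat \<Rightarrow> nat \<Rightarrow> nat \<Rightarrow> nat \<Rightarrow> nat \<Rightarrow> nat" where
  "frame tag m c x K \<equiv> npair tag (npair (npair m (npair c x)) K)"

abbreviation evaluating :: "nat \<Rightarrow> nat \<Rightarrow> nat \<Rightarrow> nat \<Rightarrow> nat" where
  "evaluating m c x K \<equiv> frame 0 m c x K"

abbreviation returning :: "nat \<Rightarrow> nat \<Rightarrow> nat" where
  "returning y K \<equiv> npair (Suc 0) (npair y K)"

text \<open>
  The instance \<open>s\<close> starts with the indices \<open>e\<close> and \<open>i\<close>, whence the shift by 2. In mode 1, the odd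
  positions of the oracle hold \<open>\<Phi>\<^sub>e p\<close>, which is computed on demand in mode 0.
\<close>

definition oracle_step :: "baire \<Rightarrow> nat \<Rightarrow> nat \<Rightarrow> nat \<Rightarrow> nat" where
  "oracle_step s m x K =
    (if m = 0 then returning (s (x + 2)) K
     else if x mod 2 = 0 then returning (s (x div 2 + 2)) K
     else evaluating 0 (s 0) (x div 2) K)"

text \<open>
  Primitive recursion at \<open>n + 1\<close> evaluates the same code at \<open>n\<close> and leaves a frame that
  applies the step program to the result; minimisation evaluates its program at 0
  and leaves a frame that remembers the candidate. The tags are those of \<^const>\<open>encode\<close>.
\<close>

definition eval_step :: "baire \<Rightarrow> nat \<Rightarrow> nat \<Rightarrow> nat \<Rightarrow> nat \<Rightarrow> nat" where
  "eval_step s m c x K = (let tag = nfst c; a = nsnd c; f = nfst a; g = nsnd a in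
     if tag = 0 then returning 0 K
     else if tag = 1 then returning (Suc x) K
     else if tag = 2 then returning (nfst x) K
     else if tag = 3 then returning (nsnd x) K
     else if tag = 4 then oracle_step s m x K
     else if tag = 5 then evaluating m f x (frame 1 m g x K)
     else if tag = 6 then evaluating m g x (frame 3 m f 0 K)
     else if tag = 7 then
       (if nsnd x = 0 then evaluating m f (nfst x) K
        else let x' = npair (nfst x) (nsnd x - 1) in evaluating m c x' (frame 4 m g x' K))
     else evaluating m a (npair x 0) (frame 5 m a (npair x 0) K))"

text \<open>
  The tag says what the value is awaited for: 1 the first component of a pair, 2 the second one,
  3 the argument of a composition, 4 the preceding value of a primitive recursion, 5 the test of a
  candidate in a minimisation. The last case makes returning to the empty stack a fixed point.
\<close>

definition return_step :: "nat \<Rightarrow> nat \<Rightarrow> nat \<Rightarrow> nat \<Rightarrow> nat \<Rightarrow> nat \<Rightarrow> nat" where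
  "return_step y tag m c x K =
    (if tag = 1 then evaluating m c x (frame 2 0 0 y K)
     else if tag = 2 then returning (npair x y) K
     else if tag = 3 then evaluating m c y K
     else if tag = 4 then evaluating m c (npair (nfst x) (npair (nsnd x) y)) K
     else if tag = 5 then
       (if y = 0 then returning (nsnd x) K
        else let x' = npair (nfst x) (Suc (nsnd x)) in evaluating m c x' (frame 5 m c x' K))
     else returning y 0)"

definition step :: "baire \<Rightarrow> nat \<Rightarrow> nat" where
  "step s z =
    (let b = nsnd z in
     if nfst z = 0
     then eval_step s (nfst (nfst b)) (nfst (nsnd (nfst b))) (nsnd (nsnd (nfst b))) (nsnd b)
     else let K = nsnd b; d = nsnd K in
       return_step (nfst b) (nfst K) (nfst (nfst d)) (nfst (nsnd (nfst d)))
         (nsnd (nsnd (nfst d))) (nsnd d))"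

lemma prod_decode_0 [simp]: "prod_decode 0 = (0, 0)"
  by (simp add: prod_decode_def prod_decode_aux.simps)

lemma step_evaluating [simp]: "step s (evaluating m c x K) = eval_step s m c x K"
  by (simp add: step_def)

lemma step_returning_frame [simp]:
  "step s (returning y (frame tag m c x K)) = return_step y tag m c x K"
  by (simp add: step_def)

lemma step_returning_empty [simp]: "step s (returning y 0) = returning y 0"
  by (simp add: step_def return_step_def)

lemma total_computable_step: "total_computable step"
proof -
  have query: "total_computable (\<lambda>s z. oracle_step s (m s z) (x s z) (K s z))"
    if "total_computable m" "total_computable x" "total_computable K" for m x K
    unfolding oracle_step_def by (intro computable_intros that)
  have evaluate: "total_computable (\<lambda>s z. eval_step s (m s z) (c s z) (x s z) (K s z))"
    if "total_computable m" "total_computable c" "total_computable x" "total_computable K"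
    for m c x K
    unfolding eval_step_def Let_def by (intro computable_intros query that)
  have return: "total_computable
      (\<lambda>s z. return_step (y s z) (t s z) (m s z) (c s z) (x s z) (K s z))"
    if "total_computable y" "total_computable t" "total_computable m" "total_computable c"
      "total_computable x" "total_computable K" for y t m c x K
    unfolding return_step_def Let_def by (intro computable_intros that)
  have "total_computable (\<lambda>s z. step s z)"
    unfolding step_def Let_def by (intro computable_intros evaluate return)
  then show ?thesis .
qed

definition reaches :: "baire \<Rightarrow> nat \<Rightarrow> nat \<Rightarrow> bool" where
  "reaches s a b \<longleftrightarrow> (\<exists>k. (step s ^^ k) a = b)"

lemma reaches_refl: "reaches s a a"
  unfolding reaches_def by (rule exI[of _ 0]) simp

lemma reaches_step: "reaches s (step s a) b \<Longrightarrow> reaches s a b"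
  unfolding reaches_def by (metis comp_apply funpow_Suc_right)

lemma reaches_one: "step s a = b \<Longrightarrow> reaches s a b"
  by (rule reaches_step) (simp add: reaches_refl)

lemma reaches_trans: "reaches s a b \<Longrightarrow> reaches s b d \<Longrightarrow> reaches s a d"
  unfolding reaches_def by (metis comp_apply funpow_add)

text \<open>
  The lemma is stated for an arbitrary mode whose oracle queries are answered correctly. It can
  therefore be used twice: for mode 0, where the machine looks up the oracle, and then
  for mode 1, where queries are answered by a simulation in mode 0.

  The stack is arbitrary, as required by the induction on the program.
\<close>

lemma machine_simulates_eval:
  assumes query: "\<And>x K. reaches s (evaluating m (encode POracle) x K) (returning (r x) K)"
  shows "eval r c x = Some y \<Longrightarrow> reaches s (evaluating m (encode c) x K) (returning y K)"
proof (induction c arbitrary: x y K)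
  case POracle
  then show ?case using query[of x K] by simp
next
  case (PPair f g)
  then obtain a b where a: "eval r f x = Some a" and b: "eval r g x = Some b"
    and y: "y = npair a b"
    by (auto simp: bind_eq_Some_conv)
  let ?K = "frame 1 m (encode g) x K" and ?L = "frame 2 0 0 a K"
  have "reaches s (evaluating m (encode f) x ?K) (returning a ?K)"
    by (rule PPair.IH(1)[OF a])
  moreover have "reaches s (returning a ?K) (returning b ?L)"
    by (rule reaches_step) (simp add: return_step_def PPair.IH(2)[OF b])
  moreover have "reaches s (returning b ?L) (returning y K)"
    by (rule reaches_step) (simp add: return_step_def y reaches_refl)
  ultimately show ?case
    by (intro reaches_step[of s "evaluating m (encode (PPair f g)) x K"])
      (auto simp: eval_step_def intro: reaches_trans)
next
  case (PComp f g)
  then obtain a where a: "eval r g x = Some a" and y: "eval r f a = Some y"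
    by (auto simp: bind_eq_Some_conv)
  let ?K = "frame 3 m (encode f) 0 K"
  have "reaches s (evaluating m (encode g) x ?K) (returning a ?K)"
    by (rule PComp.IH(2)[OF a])
  moreover have "reaches s (returning a ?K) (returning y K)"
    by (rule reaches_step) (simp add: return_step_def PComp.IH(1)[OF y])
  ultimately show ?case
    by (intro reaches_step[of s "evaluating m (encode (PComp f g)) x K"])
      (auto simp: eval_step_def intro: reaches_trans)
next
  case (PRec f g)
  have "reaches s (evaluating m (encode (PRec f g)) (npair u n) K) (returning y K)"
    if "eval r (PRec f g) (npair u n) = Some y" for u n y K
    using that
  proof (induction n arbitrary: y K)
    case 0
    then have "eval r f u = Some y" by simp
    then show ?case
      by (intro reaches_step[of s "evaluating m (encode (PRec f g)) (npair u 0) K"])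
        (simp add: eval_step_def PRec.IH(1))
  next
    case (Suc n)
    then obtain b where b: "eval r (PRec f g) (npair u n) = Some b"
      and y: "eval r g (npair u (npair n b)) = Some y"
      by (auto simp: bind_eq_Some_conv)
    let ?K = "frame 4 m (encode g) (npair u n) K"
    have "reaches s (evaluating m (encode (PRec f g)) (npair u n) ?K) (returning b ?K)"
      by (rule Suc.IH[OF b])
    moreover have "reaches s (returning b ?K) (returning y K)"
      by (rule reaches_step) (simp add: return_step_def PRec.IH(2)[OF y])
    ultimately show ?case
      by (intro reaches_step[of s "evaluating m (encode (PRec f g)) (npair u (Suc n)) K"])
        (auto simp: eval_step_def Let_def intro: reaches_trans)
  qed
  from this[of "nfst x" "nsnd x" y K] PRec.prems show ?case by simp
next
  case (PMu f)
  let ?P = "\<lambda>n. eval r f (npair x n) = Some 0"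
  from PMu.prems obtain n where n: "?P n" "\<forall>j<n. eval r f (npair x j) \<noteq> None"
    and y: "y = (LEAST n. ?P n)"
    by (auto split: if_splits)
  have Py: "?P y" unfolding y by (rule LeastI) (rule n(1))
  have "y \<le> n" unfolding y by (rule Least_le) (rule n(1))
  \<comment> \<open>The candidates below the least zero are rejected one by one; hence induction downwards from it.\<close>
  let ?search = "\<lambda>j. evaluating m (encode f) (npair x j) (frame 5 m (encode f) (npair x j) K)"
  have "reaches s (?search j) (returning y K)" if "j \<le> y" for j
    using that
  proof (induction rule: inc_induct)
    case base
    show ?case
      by (rule reaches_trans[OF PMu.IH[OF Py] reaches_step])
        (simp add: return_step_def reaches_refl)
  next
    case (step j)
    then obtain b where b: "eval r f (npair x j) = Some b"
      using n(2) \<open>y \<le> n\<close> by (meson not_Some_eq order_less_le_trans)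
    moreover have "b \<noteq> 0" using b step.hyps not_less_Least[of j ?P] by (auto simp: y)
    ultimately show ?case
      by (intro reaches_trans[OF PMu.IH[OF b] reaches_step])
        (simp add: return_step_def Let_def step.IH)
  qed
  from this[of 0] show ?case
    by (intro reaches_step[of s "evaluating m (encode (PMu f)) x K"])
      (simp add: eval_step_def Let_def)
qed (auto intro!: reaches_one simp: eval_step_def)


lemma machine_runs_functional:
  assumes "Phi e (\<lambda>n. s (n + 2)) = Some r"
    and "Phi i (pair_seq (\<lambda>n. s (n + 2)) r) = Some v"
    and "e = s 0"
  shows "reaches s (evaluating 1 i n 0) (returning (v n) 0)"
proof -
  let ?p = "\<lambda>n. s (n + 2)"
  obtain c where c: "encode c = e" and r: "functional c ?p = Some r"
    using assms(1) by (metis Phi_def Phi_encode option.distinct(1))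
  obtain d where d: "encode d = i" and v: "functional d (pair_seq ?p r) = Some v"
    using assms(2) by (metis Phi_def Phi_encode option.distinct(1))
  have r_eval: "eval ?p c x = Some (r x)" for x
    using r by (auto simp: functional_def split: if_splits)
  have v_eval: "eval (pair_seq ?p r) d x = Some (v x)" for x
    using v by (auto simp: functional_def split: if_splits)
  have "reaches s (evaluating 0 (encode POracle) x K) (returning (?p x) K)" for x K
    by (rule reaches_step) (simp add: eval_step_def oracle_step_def reaches_refl)
  from machine_simulates_eval[OF this r_eval]
  have inner: "reaches s (evaluating 0 e x K) (returning (r x) K)" for x K
    by (simp add: c)
  have "reaches s (evaluating 1 (encode POracle) x K) (returning (pair_seq ?p r x) K)" for x K
  proof (rule reaches_step, cases "even x")
    case True
    then show "reaches s (step s (evaluating 1 (encode POracle) x K))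
        (returning (pair_seq ?p r x) K)"
      by (simp add: eval_step_def oracle_step_def pair_seq_def reaches_refl)
  next
    case False
    then have "x mod 2 = 1" by presburger
    with False inner[of "x div 2" K]
    show "reaches s (step s (evaluating 1 (encode POracle) x K))
        (returning (pair_seq ?p r x) K)"
      by (simp add: eval_step_def oracle_step_def pair_seq_def assms(3))
  qed
  from machine_simulates_eval[OF this v_eval] show ?thesis by (simp add: d)
qed

section \<open>Turning totality into infinitely many events\<close>

definition initial :: "baire \<Rightarrow> nat \<Rightarrow> nat" where
  "initial s n = evaluating 1 (s 1) n 0"

definition halted :: "nat \<Rightarrow> bool" where
  "halted z \<longleftrightarrow> nfst z = 1 \<and> nsnd (nsnd z) = 0"

text \<open>
  The run works on pairs of an input and a configuration; having finished an input it goes on to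
  the next one.
\<close>

definition run_step :: "baire \<Rightarrow> nat \<Rightarrow> nat" where
  "run_step s Z = (if halted (nsnd Z)
     then npair (Suc (nfst Z)) (initial s (Suc (nfst Z)))
     else npair (nfst Z) (step s (nsnd Z)))"

definition run :: "baire \<Rightarrow> nat \<Rightarrow> nat" where
  "run s t = (run_step s ^^ t) (npair 0 (initial s 0))"

definition flag :: "baire \<Rightarrow> nat \<Rightarrow> nat" where
  "flag s t = (if halted (nsnd (run s t)) then 0 else 1)"

lemma run_0: "run s 0 = npair 0 (initial s 0)"
  by (simp add: run_def)

lemma run_Suc: "run s (Suc t) = run_step s (run s t)"
  by (simp add: run_def)

lemma total_computable_if_halted:
  assumes "total_computable z" "total_computable a" "total_computable b"
  shows "total_computable (\<lambda>p x. if halted (z p x) then a p x else b p x)"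
proof -
  have "total_computable (\<lambda>p x. if nfst (z p x) = 1
      then if nsnd (nsnd (z p x)) = 0 then a p x else b p x else b p x)"
    by (intro computable_intros assms)
  moreover have "(if nfst z = 1 then if nsnd (nsnd z) = 0 then u else v else v) =
      (if halted z then u else v)" for z u v :: nat
    by (simp add: halted_def)
  ultimately show ?thesis by (simp only:)
qed

lemma total_computable_run: "total_computable run"
proof -
  have "total_computable (\<lambda>s Z. run_step s Z)"
    unfolding run_step_def initial_def
    by (intro total_computable_if_halted computable_intros
        total_computable_compose[OF total_computable_step])
  then have "total_computable (\<lambda>s t. run s t)"
    unfolding run_def initial_def by (intro computable_intros) auto
  then show ?thesis .
qed

lemma total_computable_flag: "total_computable flag"
proof -
  have "total_computable (\<lambda>s t. flag s t)"
    unfolding flag_def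
    by (intro total_computable_if_halted computable_intros
        total_computable_compose[OF total_computable_run])
  then show ?thesis .
qed

lemma halted_fixed:
  assumes "halted z"
  shows "(step s ^^ k) z = z"
proof -
  have "returning (nfst (nsnd z)) 0 = npair (nfst z) (npair (nfst (nsnd z)) (nsnd (nsnd z)))"
    using assms by (simp add: halted_def)
  also have "\<dots> = z" by simp
  finally have "step s z = z" using step_returning_empty[of s "nfst (nsnd z)"] by simp
  then show ?thesis by (induction k) auto
qed

text \<open>
  Since halting configurations are fixed points, the value does not depend on the
  stage at which it is read off.
\<close>

lemma halted_unique:
  assumes "halted ((step s ^^ j) a)" "halted ((step s ^^ k) a)"
  shows "(step s ^^ j) a = (step s ^^ k) a"
proof -
  have "(step s ^^ (k + j)) a = (step s ^^ j) a" "(step s ^^ (j + k)) a = (step s ^^ k) a"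
    using assms by (simp_all add: funpow_add halted_fixed)
  then show ?thesis by (simp add: add.commute)
qed

lemma run_invariant:
  "\<exists>k. run s t = npair (nfst (run s t)) ((step s ^^ k) (initial s (nfst (run s t))))"
proof (induction t)
  case 0
  show ?case by (rule exI[of _ 0]) (simp add: run_0)
next
  case (Suc t)
  then obtain k n where k: "run s t = npair n ((step s ^^ k) (initial s n))" by blast
  show ?case
  proof (cases "halted (nsnd (run s t))")
    case True
    then show ?thesis by (intro exI[of _ 0]) (simp add: run_Suc run_step_def)
  next
    case False
    then show ?thesis by (intro exI[of _ "Suc k"]) (simp add: run_Suc run_step_def k)
  qed
qed

lemma run_advance:
  assumes "run s t = npair n a" "\<And>i. i < j \<Longrightarrow> \<not> halted ((step s ^^ i) a)"
  shows "run s (t + j) = npair n ((step s ^^ j) a)"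
  using assms(2)
proof (induction j)
  case 0
  then show ?case by (simp add: assms(1))
next
  case (Suc j)
  then show ?case by (simp add: run_Suc run_step_def)
qed

text \<open>
  The stage is the first one at which the computation on the input halts: until then the run
  follows the machine, and at that stage it moves on.
\<close>

lemma run_halts_from:
  assumes "run s t = npair n (initial s n)" "halted ((step s ^^ k) (initial s n))"
  obtains t' where "nfst (run s t') = n" "halted (nsnd (run s t'))"
    "run s (Suc t') = npair (Suc n) (initial s (Suc n))"
proof -
  let ?h = "\<lambda>j. halted ((step s ^^ j) (initial s n))"
  have "?h (LEAST j. ?h j)" by (rule LeastI[of ?h]) (rule assms(2))
  moreover have "run s (t + (LEAST j. ?h j)) = npair n ((step s ^^ (LEAST j. ?h j)) (initial s n))"
    by (rule run_advance[OF assms(1)]) (rule not_less_Least)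
  ultimately show thesis
    by (intro that[of "t + (LEAST j. ?h j)"]) (simp_all add: run_Suc run_step_def)
qed

text \<open>
  The hypothesis only concerns inputs that the run really starts on, so that it can be obtained
  both from totality and from the mere fact that the run halts infinitely often.
\<close>

lemma run_halts_on_every_input:
  assumes "\<And>t n. run s t = npair n (initial s n) \<Longrightarrow> \<exists>k. halted ((step s ^^ k) (initial s n))"
  shows "\<exists>t. nfst (run s t) = n \<and> halted (nsnd (run s t))"
proof -
  have "\<exists>t. run s t = npair n (initial s n)"
  proof (induction n)
    case 0
    show ?case using run_0 by blast
  next
    case (Suc n)
    then show ?case using assms run_halts_from by metis
  qed
  then show ?thesis using assms run_halts_from by metis
qed

text \<open>
  A run that never finishes an input stays on it forever and raises no further flag; so if there
  are infinitely many flags, every input that is started is finished.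
\<close>

lemma run_halts_if_infinitely_many_flags:
  assumes "infinite {t. flag s t = 0}"
  shows "\<exists>t. nfst (run s t) = n \<and> halted (nsnd (run s t))"
proof (rule run_halts_on_every_input, rule ccontr)
  fix t n
  assume t: "run s t = npair n (initial s n)"
    and "\<nexists>k. halted ((step s ^^ k) (initial s n))"
  then have never: "\<not> halted ((step s ^^ k) (initial s n))" for k by blast
  obtain t' where "t' \<ge> t" "flag s t' = 0"
    using assms unfolding infinite_nat_iff_unbounded_le by blast
  moreover have "run s (t + (t' - t)) = npair n ((step s ^^ (t' - t)) (initial s n))"
    by (rule run_advance[OF t]) (rule never)
  ultimately show False using never by (simp add: flag_def split: if_splits)
qed

text \<open>Every number is the input at some flagged stage, so the flagged stages cannot be finite.\<close>

lemma infinitely_many_flags: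
  assumes "\<And>n. \<exists>k. halted ((step s ^^ k) (initial s n))"
  shows "infinite {t. flag s t = 0}"
proof
  assume "finite {t. flag s t = 0}"
  then have "finite ((\<lambda>t. nfst (run s t)) ` {t. flag s t = 0})" by simp
  moreover have "(\<lambda>t. nfst (run s t)) ` {t. flag s t = 0} = UNIV"
  proof (intro equalityI subsetI)
    fix n :: nat
    obtain t where "nfst (run s t) = n" "halted (nsnd (run s t))"
      using run_halts_on_every_input[OF assms] by blast
    then show "n \<in> (\<lambda>t. nfst (run s t)) ` {t. flag s t = 0}"
      by (intro image_eqI[of _ _ t]) (simp_all add: flag_def)
  qed simp
  ultimately show False by simp
qed

section \<open>The two reductions\<close>

lemma W_leI:
  assumes "\<forall>p. functional a p = Some (F p)"
    and "\<And>p. F p \<in> pdom g"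
    and "\<And>p q. q \<in> g (F p) \<Longrightarrow> \<exists>v. functional b (pair_seq p q) = Some v \<and> v \<in> f p"
  shows "f \<le>W g"
proof -
  have "computable_functional (functional c)" for c
    unfolding computable_functional_def by blast
  then show ?thesis unfolding W_le_def using assms by metis
qed

lemma X_Pi_nonempty: "X_Pi p \<noteq> {}"
proof -
  have "(\<lambda>n. if infinite {n. p n = 0} then 0 else 1) \<in> X_Pi p" by (simp add: X_Pi_def)
  then show ?thesis by blast
qed

lemma tot_jump_id_problem:
  "tot_jump id_problem e i p =
    (case Option.bind (Phi e p) (\<lambda>r. Phi i (pair_seq p r)) of None \<Rightarrow> UNIV | Some v \<Rightarrow> {v})"
  by (auto simp: tot_jump_def id_problem_def pdom_def split: option.split bind_splits)

text \<open>
  Here \<open>e\<close> is an index of the identity and \<open>i\<close> one of the search for the next zero. The oracle of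
  the latter is the pair of \<open>p\<close> with itself, which holds \<open>p\<close> at the even positions.
\<close>

lemma X_Pi_le_tJ_id: "X_Pi \<le>W tJ id_problem"
proof -
  have "Phi (encode POracle) p = Some p" for p
    by (simp only: Phi_encode) (simp add: functional_def)
  then obtain e where e: "\<And>p. Phi e p = Some p" by blast
  have "total_computable (\<lambda>p x. p (2 * (nfst x + nsnd x)))"
    unfolding mult_2 by (intro computable_intros)
  moreover have "total_computable (\<lambda>p x. nsnd x)" by (intro computable_intros)
  ultimately have "\<exists>d. \<forall>p. (\<forall>n. \<exists>m. p (2 * (n + m)) = 0) \<longrightarrow>
      functional d p = Some (\<lambda>n. LEAST m. p (2 * (n + m)) = 0)"
    using search_functional[of "\<lambda>p x. p (2 * (nfst x + nsnd x))" "\<lambda>p x. nsnd x"]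
    by (simp only: prod_encode_inverse fst_conv snd_conv)
  then obtain d where "\<forall>p. (\<forall>n. \<exists>m. p (2 * (n + m)) = 0) \<longrightarrow>
      Phi (encode d) p = Some (\<lambda>n. LEAST m. p (2 * (n + m)) = 0)"
    unfolding Phi_encode ..
  then obtain i where i: "\<And>p. \<forall>n. \<exists>m. p (2 * (n + m)) = 0 \<Longrightarrow>
      Phi i p = Some (\<lambda>n. LEAST m. p (2 * (n + m)) = 0)"
    by blast
  let ?F = "\<lambda>p. cons_seq e (cons_seq i p)"
  let ?G = "\<lambda>u n. u (2 * (n + u (Suc (2 * n))))"
  have "total_computable (\<lambda>p n. if n = 0 then e else if n = 1 then i else p (n - 2))"
    by (intro computable_intros)
  moreover have "(\<lambda>p n. if n = 0 then e else if n = 1 then i else p (n - 2)) = ?F"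
    by (auto simp: fun_eq_iff cons_seq_def numeral_2_eq_2 split: nat.split)
  ultimately have "total_computable ?F" by simp
  then obtain a where a: "\<forall>p. functional a p = Some (?F p)" using total_functional[of ?F] by blast
  have "total_computable (\<lambda>u n. u (2 * (n + u (Suc (2 * n)))))"
    unfolding mult_2 by (intro computable_intros)
  then obtain b where b: "\<forall>u. functional b u = Some (?G u)"
    using total_functional[of ?G] by blast
  have correct: "?G (pair_seq p q) \<in> X_Pi p" if q: "q \<in> tJ id_problem (?F p)" for p q
  proof -
    have G: "?G (pair_seq p q) = (\<lambda>n. p (n + q n))" by (auto simp: pair_seq_def)
    show ?thesis
    proof (cases "infinite {n. p n = 0}")
      case True
      have ex: "\<exists>m. p (n + m) = 0" for n
      proof -
        obtain k where "k \<ge> n" "p k = 0"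
          using True unfolding infinite_nat_iff_unbounded_le by blast
        then show ?thesis by (intro exI[of _ "k - n"]) simp
      qed
      have "Phi i (pair_seq p p) = Some (\<lambda>n. LEAST m. p (n + m) = 0)"
        using i[of "pair_seq p p"] ex by (simp add: pair_seq_def)
      with q have "q = (\<lambda>n. LEAST m. p (n + m) = 0)"
        by (simp add: tJ_cons_seq tot_jump_id_problem e)
      then have "p (n + q n) = 0" for n using LeastI_ex[OF ex[of n]] by simp
      then show ?thesis using True unfolding G by (simp add: X_Pi_def)
    next
      case False
      then obtain N where "\<forall>n\<in>{n. p n = 0}. n < N"
        unfolding finite_nat_set_iff_bounded not_not ..
      then have "p (N + q N) \<noteq> 0" by fastforce
      then show ?thesis using False unfolding G by (auto simp: X_Pi_def)
    qed
  qed
  have "?F p \<in> pdom (tJ id_problem)" for p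
    by (auto simp: pdom_def tJ_cons_seq tot_jump_id_problem split: option.split)
  then show ?thesis using correct b by (intro W_leI[OF a]) blast+
qed

text \<open>
  The second functional sees the pair of the instance \<open>s\<close> and the answer \<open>q\<close>, so that the machine
  has to be run relative to the even part of its oracle.
\<close>

lemma tJ_id_le_X_Pi: "tJ id_problem \<le>W X_Pi"
proof -
  obtain a where a: "\<forall>s. functional a s = Some (flag s)"
    using total_functional[OF total_computable_flag] ..
  let ?s = "\<lambda>u k. u (2 * k)" and ?q = "\<lambda>u k. u (Suc (2 * k))"
  let ?run = "\<lambda>u t. run (?s u) t"
  \<comment> \<open>Nested conditionals, as the introduction rules handle single equations: the test is zero if the
    run has finished the given input, or \<open>q\<close> is nonzero at the stage.\<close>
  define test where "test u x = (if nfst (?run u (nsnd x)) = nfst x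
      then if halted (nsnd (?run u (nsnd x))) then 0 else if ?q u (nsnd x) = 0 then 1 else 0
      else if ?q u (nsnd x) = 0 then 1 else (0 :: nat))" for u and x :: nat
  define out where "out u x = nfst (nsnd (nsnd (?run u (nsnd x))))" for u and x :: nat
  have "total_computable ?s" unfolding mult_2 by (intro computable_intros)
  then have "total_computable ?run"
    by (rule total_computable_change_oracle[OF total_computable_run])
  note run = total_computable_compose[OF this]
  have test_comp: "total_computable test"
    unfolding test_def mult_2[of "nsnd _"]
    by (intro total_computable_if_halted computable_intros run)
  have out_comp: "total_computable out"
    unfolding out_def by (intro computable_intros run)
  from search_functional[OF test_comp out_comp]
  obtain b where b: "\<forall>u. (\<forall>n. \<exists>t. test u (npair n t) = 0) \<longrightarrow>
      functional b u = Some (\<lambda>n. out u (npair n (LEAST t. test u (npair n t) = 0)))"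
    ..
  have correct: "\<exists>v. functional b (pair_seq s q) = Some v \<and> v \<in> tJ id_problem s"
    if q: "q \<in> X_Pi (flag s)" for s q
  proof -
    let ?found = "\<lambda>n t. nfst (run s t) = n \<and> halted (nsnd (run s t)) \<or> q t \<noteq> 0"
    let ?out = "\<lambda>n. nfst (nsnd (nsnd (run s (LEAST t. ?found n t))))"
    have found: "\<exists>t. ?found n t" for n
    proof (cases "\<forall>t. q t = 0")
      case True
      then have "infinite {t. flag s t = 0}" using q by (simp add: X_Pi_def)
      then show ?thesis using run_halts_if_infinitely_many_flags by blast
    next
      case False
      then obtain t where "q t \<noteq> 0" by blast
      then show ?thesis by (intro exI[of _ t]) simp
    qed
    have test: "test (pair_seq s q) (npair n t) = 0 \<longleftrightarrow> ?found n t" for n t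
      by (simp add: test_def pair_seq_def)
    have "out (pair_seq s q) (npair n t) = nfst (nsnd (nsnd (run s t)))" for n t
      by (simp add: out_def pair_seq_def)
    then have b': "functional b (pair_seq s q) = Some ?out"
      using b[rule_format, of "pair_seq s q"] found by (simp add: test)
    have "?out \<in> tJ id_problem s"
    proof (cases "Option.bind (Phi (s 0) (\<lambda>n. s (n + 2)))
        (\<lambda>r. Phi (s 1) (pair_seq (\<lambda>n. s (n + 2)) r))")
      case None
      then show ?thesis by (simp add: tJ_def tot_jump_id_problem)
    next
      case (Some v)
      have reach: "reaches s (initial s n) (returning (v n) 0)" for n
        using Some machine_runs_functional
        unfolding initial_def by (auto simp: bind_eq_Some_conv)
      have halted_v: "halted (returning y 0)" for y by (simp add: halted_def)
      have halts: "\<exists>k. halted ((step s ^^ k) (initial s n))" for n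
        using reach[of n] halted_v unfolding reaches_def by metis
      have "infinite {t. flag s t = 0}" by (rule infinitely_many_flags[OF halts])
      then have q0: "q t = 0" for t using q by (simp add: X_Pi_def)
      have "?out n = v n" for n
      proof -
        let ?t = "LEAST t. ?found n t"
        have t: "nfst (run s ?t) = n" "halted (nsnd (run s ?t))"
          using LeastI_ex[OF found[of n]] q0 by auto
        obtain k where k: "nsnd (run s ?t) = (step s ^^ k) (initial s n)"
        proof -
          obtain k where "run s ?t = npair n ((step s ^^ k) (initial s n))"
            using run_invariant[of s ?t] unfolding t(1) by blast
          then have "nsnd (run s ?t) = (step s ^^ k) (initial s n)" by simp
          then show thesis by (rule that)
        qed
        obtain j where j: "(step s ^^ j) (initial s n) = returning (v n) 0"
          using reach[of n] unfolding reaches_def by blast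
        have "nsnd (run s ?t) = returning (v n) 0"
          using halted_unique[of k s "initial s n" j] t(2) halted_v[of "v n"]
          unfolding k j by blast
        then show ?thesis by simp
      qed
      then show ?thesis using Some by (simp add: tJ_def tot_jump_id_problem fun_eq_iff)
    qed
    with b' show ?thesis by blast
  qed
  show ?thesis
    using correct X_Pi_nonempty by (intro W_leI[OF a]) (auto simp: pdom_def)
qed

theorem theorem4p4: "tJ id_problem \<equiv>W X_Pi"
  unfolding W_equiv_def using tJ_id_le_X_Pi X_Pi_le_tJ_id by blast

end
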